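(* For any $\varepsilon\in(0,1]$ and $(\mu,\nu)\in\mathcal P_4(\mathbb R^{d_x})\times\mathcal P_4(\mathbb R^{d_y})$, $$\big|\mathsf S_\varepsilon(\mu,\nu)-\mathsf D(\mu,\nu)^2\big|\lesssim_{d_x,d_y,M_4(\mu),M_4(\nu)}\varepsilon\log\frac1\varepsilon.$$
   Context: $\mathcal P_4(\mathbb R^d)$ is the set of Borel probability measures $\rho$ on $\mathbb R^d$ with $M_4(\rho):=\int\|x\|^4\,d\rho(x)<\infty$, where $\|\cdot\|$ is the Euclidean norm. $\lesssim_{z}$ denotes inequality up to a multiplicative constant depending only on $z$. $\Pi(\mu,\nu)$ is the set of couplings of $\mu$ and $\nu$. $\mathsf D_{\mathsf{KL}}(\alpha\|\beta)=\int\log(d\alpha/d\beta)\,d\alpha$ if $\alpha\ll\beta$ and $+\infty$ otherwise. The squared $(2,2)$-Gromov-Wasserstein distance and its entropic version are $$\mathsf D(\mu,\nu)^2:=\inf_{\pi\in\Pi(\mu,\nu)}\iint\big|\|x-x'\|^2-\|y-y'\|^2\big|^2\,d\pi\otimes\pi(x,y,x',y'),$$ $$\mathsf S_\varepsilon(\mu,\nu):=\inf_{\pi\in\Pi(\mu,\nu)}\left\{\iint\big|\|x-x'\|^2-\|y-y'\|^2\big|^2\,d\pi\otimes\pi(x,y,x',y')+\varepsilon\,\mathsf D_{\mathsf{KL}}(\pi\|\mu\otimes\nu)\right\}.$$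
   Formalization: The rate ε log(1/ε) is replaced by ε·max(1, log(1/ε)): as printed the bound fails at and near ε=1 (e.g. μ=ν uniform on two points, where D=0 but S_1>0). For ε ≤ 1/e the rate is as printed. *)

theory Defs
  imports "HOL-Probability.Probability"
begin

definition P4 :: "'a::euclidean_space measure set" where
  "P4 = {\<rho>. prob_space \<rho> \<and> sets \<rho> = sets borel \<and> integrable \<rho> (\<lambda>x. norm x ^ 4)}"

definition M4 :: "'a::euclidean_space measure \<Rightarrow> real" where
  "M4 \<rho> = (\<integral>x. norm x ^ 4 \<partial>\<rho>)"

definition couplings :: "'a measure \<Rightarrow> 'b measure \<Rightarrow> ('a \<times> 'b) measure set" where
  "couplings \<mu> \<nu> =
     {\<pi>. prob_space \<pi> \<and> sets \<pi> = sets (\<mu> \<Otimes>\<^sub>M \<nu>) \<and> distr \<pi> \<mu> fst = \<mu> \<and> distr \<pi> \<nu> snd = \<nu>}"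

(* The library's KL_divergence takes the reference measure first and is real-valued: it is a
   Bochner integral, hence 0 when the log-density is not integrable. For probability measures
   a << b the negative part of log (da/db) always has finite a-integral, so a non-integrable
   log-density means that the integral is +infinity. *)
definition D_KL :: "'a measure \<Rightarrow> 'a measure \<Rightarrow> ereal" where
  "D_KL \<alpha> \<beta> =
     (if absolutely_continuous \<beta> \<alpha> \<and> integrable \<alpha> (entropy_density (exp 1) \<beta> \<alpha>)
      then ereal (KL_divergence (exp 1) \<beta> \<alpha>) else \<infinity>)"

definition gw_cost :: "('a::euclidean_space \<times> 'b::euclidean_space) measure \<Rightarrow> ereal" where
  "gw_cost \<pi> = enn2ereal (\<integral>\<^sup>+ ((x, y), (x', y')).
     ennreal (\<bar>(norm (x - x'))\<^sup>2 - (norm (y - y'))\<^sup>2\<bar>\<^sup>2) \<partial>(\<pi> \<Otimes>\<^sub>M \<pi>))"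

(* The infimum is the square of the (2,2)-Gromov-Wasserstein distance, not the distance. *)
definition GW_sq :: "'a::euclidean_space measure \<Rightarrow> 'b::euclidean_space measure \<Rightarrow> ereal" where
  "GW_sq \<mu> \<nu> = (INF \<pi>\<in>couplings \<mu> \<nu>. gw_cost \<pi>)"

definition EGW :: "real \<Rightarrow> 'a::euclidean_space measure \<Rightarrow> 'b::euclidean_space measure \<Rightarrow> ereal" where
  "EGW \<epsilon> \<mu> \<nu> =
     (INF \<pi>\<in>couplings \<mu> \<nu>. gw_cost \<pi> + ereal \<epsilon> * D_KL \<pi> (\<mu> \<Otimes>\<^sub>M \<nu>))"

(* The rate eps log(1/eps), with the logarithm replaced by 1 where it is smaller than 1, i.e. for
   eps > 1/e. Without the cut-off the rate vanishes at eps = 1, while EGW 1 and GW_sq differ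
   already for mu = nu uniform on two points. *)
definition eps_log_rate :: "real \<Rightarrow> real" where
  "eps_log_rate \<epsilon> = \<epsilon> * max 1 (ln (1 / \<epsilon>))"

end

theory Submission
  imports Defs "HOL-Analysis.Infinite_Set_Sum"
begin

text \<open>
The lower bound \<open>GW_sq \<mu> \<nu> \<le> EGW \<epsilon> \<mu> \<nu>\<close> is nonnegativity of the relative entropy. The upper bound
compares an arbitrary coupling \<open>\<pi>\<close> with its \<^emph>\<open>block approximation\<close> \<open>\<pi>'\<close>: both spaces are cut into
cubes of side \<open>\<epsilon>\<close>, and inside each product cell \<open>A \<times> B\<close> the coupling is replaced by the multiple of
\<open>\<mu> \<otimes> \<nu>\<close> that has the mass \<open>\<pi>(A \<times> B)\<close>. The measure \<open>\<pi>'\<close> is again a coupling of \<open>\<mu>\<close> and \<open>\<nu>\<close>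
(\<open>block_coupling_in_couplings\<close>), and it gives the same mass to every product cell as \<open>\<pi>\<close>.

\<^emph>\<open>Transport cost.\<close> Rounding every point to the corner of its cell moves it by \<open>O(\<epsilon>)\<close> and therefore
changes the cost of any coupling by \<open>O(\<epsilon>)\<close>, with a constant controlled by the fourth moments
(\<open>gw_cost_perturb\<close>). Since \<open>\<pi>\<close> and \<open>\<pi>'\<close> have the same image under rounding, their costs differ by
\<open>O(\<epsilon>)\<close>.

\<^emph>\<open>Entropy.\<close> The density of \<open>\<pi>'\<close> on the cell \<open>A \<times> B\<close> is \<open>\<pi>(A \<times> B) / (\<mu>(A) \<nu>(B)) \<le> 1 / \<nu>(B)\<close>, so that the
relative entropy of \<open>\<pi>'\<close> is at most the Shannon entropy of the cells under \<open>\<nu>\<close>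
(\<open>D_KL_block_coupling_le\<close>). By Gibbs' inequality (\<open>cell_entropy_le\<close>) the latter is bounded by
\<open>\<integral> ln (1/w) d\<nu> + \<Sum> w\<close> for any positive weight \<open>w\<close> on the cells. A summable weight with polynomial decay in
the integer coordinates of the cell gives \<open>O(ln (1/\<epsilon>) + 1)\<close>, because a point \<open>y\<close> lies in a cell with
coordinates of size \<open>\<parallel>y\<parallel>/\<epsilon> + 1\<close> (\<open>grid_entropy_le\<close>).

Multiplying the entropy by \<open>\<epsilon>\<close> and taking the infimum over \<open>\<pi>\<close> gives the theorem.
\<close>

section \<open>Relative entropy\<close>

lemma D_KL_nonneg:
  assumes "prob_space \<alpha>" "prob_space \<beta>" and sets_eq: "sets \<alpha> = sets \<beta>"
  shows "0 \<le> D_KL \<alpha> \<beta>"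
proof (cases "absolutely_continuous \<beta> \<alpha> \<and> integrable \<alpha> (entropy_density (exp 1) \<beta> \<alpha>)")
  case True
  interpret a: prob_space \<alpha> by fact
  interpret b: prob_space \<beta> by fact
  interpret b: information_space \<beta> "exp 1" by standard simp
  from True have ac: "absolutely_continuous \<beta> \<alpha>"
    and int: "integrable \<alpha> (entropy_density (exp 1) \<beta> \<alpha>)" by auto
  have "finite_measure \<alpha>" by unfold_locales
  from b.real_RN_deriv[OF this ac sets_eq] obtain D where D:
      "D \<in> borel_measurable \<beta>" "AE x in \<beta>. RN_deriv \<beta> \<alpha> x = ennreal (D x)"
      "AE x in \<alpha>. 0 < D x" "\<And>x. 0 \<le> D x"
    by auto
  have "\<alpha> = density \<beta> (RN_deriv \<beta> \<alpha>)"
    using ac sets_eq by (rule b.density_RN_deriv[symmetric])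
  also have "\<dots> = density \<beta> D"
    using D by (auto intro!: density_cong)
  finally have \<alpha>: "\<alpha> = density \<beta> D" .
  have "integrable \<alpha> (\<lambda>x. log (exp 1) (D x))"
    using absolutely_continuous_AE[OF sets_eq ac D(2)] D int
      measurable_entropy_density[of "exp 1" \<beta> \<alpha>]
    by (intro integrable_cong_AE[THEN iffD2, OF _ _ _ int])
       (auto simp: \<alpha> entropy_density_def)
  with D have "integrable \<beta> (\<lambda>x. D x * log (exp 1) (D x))"
    by (subst integrable_real_density[symmetric]) (auto simp: \<alpha>[symmetric] comp_def)
  then have "0 \<le> KL_divergence (exp 1) \<beta> (density \<beta> D)"
    using D \<open>prob_space \<alpha>\<close> by (intro b.KL_nonneg) (auto simp: \<alpha>[symmetric])
  then show ?thesis using True by (simp add: D_KL_def \<alpha>[symmetric])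
qed (auto simp: D_KL_def)

lemma mult_ln_ge_minus_one: "- 1 \<le> t * ln t" if "0 \<le> t" for t :: real
proof (cases "t = 0")
  case False
  then have "ln (1 / t) \<le> 1 / t - 1" using that by (intro ln_le_minus_one) auto
  then have "t * ln (1 / t) \<le> t * (1 / t - 1)" using that by (intro mult_left_mono) auto
  also have "\<dots> \<le> 1" using False that by (simp add: field_simps)
  finally show ?thesis using False that by (simp add: ln_div)
qed simp

text \<open>The bound \<open>ln f \<le> g\<close> on the log-density controls only the positive part of the integrand
\<open>f ln f\<close>; the negative part is bounded by \<open>1\<close>, so the log-density is integrable and \<open>D_KL\<close> is
finite.\<close>
lemma D_KL_density_le:
  fixes f g :: "'a \<Rightarrow> real"
  assumes "prob_space \<beta>"
    and [measurable]: "f \<in> borel_measurable \<beta>" and f_nonneg: "\<And>x. 0 \<le> f x"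
    and g_nonneg: "\<And>x. 0 \<le> g x" and f_le: "\<And>x. f x \<le> exp (g x)"
    and int_g: "integrable (density \<beta> f) g"
  shows "D_KL (density \<beta> f) \<beta> \<le> ereal (\<integral>x. g x \<partial>density \<beta> f)"
proof -
  interpret b: prob_space \<beta> by fact
  have [measurable]: "g \<in> borel_measurable \<beta>"
    using borel_measurable_integrable[OF int_g] by simp
  have ac: "absolutely_continuous \<beta> (density \<beta> f)"
    by (rule absolutely_continuousI_density) measurable
  have "AE x in \<beta>. ennreal (f x) = RN_deriv \<beta> (density \<beta> f) x"
    by (rule b.RN_deriv_unique) auto
  then have "AE x in \<beta>. entropy_density (exp 1) \<beta> (density \<beta> f) x = ln (f x)"
    by eventually_elim (metis comp_apply enn2real_ennreal entropy_density_def f_nonneg log_ln)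
  then have ed: "AE x in density \<beta> f. entropy_density (exp 1) \<beta> (density \<beta> f) x = ln (f x)"
    by (rule absolutely_continuous_AE[OF _ ac, rotated]) simp
  have [measurable]: "entropy_density (exp 1) \<beta> (density \<beta> f) \<in> borel_measurable (density \<beta> f)"
    by simp
  have ln_le: "f x * ln (f x) \<le> f x * g x" for x
  proof (cases "f x = 0")
    case False
    then have "ln (f x) \<le> ln (exp (g x))"
      using f_nonneg[of x] f_le[of x] by (subst ln_le_cancel_iff) auto
    then show ?thesis using f_nonneg[of x] by (intro mult_left_mono) auto
  qed simp
  have int_fg: "integrable \<beta> (\<lambda>x. f x * g x)"
    using int_g f_nonneg by (subst (asm) integrable_real_density) auto
  have int_flnf: "integrable \<beta> (\<lambda>x. f x * ln (f x))"
  proof (rule Bochner_Integration.integrable_bound)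
    show "integrable \<beta> (\<lambda>x. 1 + f x * g x)" using int_fg by simp
    show "AE x in \<beta>. norm (f x * ln (f x)) \<le> norm (1 + f x * g x)"
    proof (rule AE_I2)
      fix x show "norm (f x * ln (f x)) \<le> norm (1 + f x * g x)"
        using ln_le[of x] mult_ln_ge_minus_one[OF f_nonneg[of x]]
          mult_nonneg_nonneg[OF f_nonneg[of x] g_nonneg[of x]]
        unfolding real_norm_def by linarith
    qed
  qed measurable
  have int_ln: "integrable (density \<beta> f) (\<lambda>x. ln (f x))"
    using int_flnf f_nonneg by (subst integrable_real_density) auto
  have int: "integrable (density \<beta> f) (entropy_density (exp 1) \<beta> (density \<beta> f))"
    by (rule integrable_cong_AE[THEN iffD2, OF _ _ ed int_ln]) measurable
  have "KL_divergence (exp 1) \<beta> (density \<beta> f) = (\<integral>x. ln (f x) \<partial>density \<beta> f)"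
    unfolding KL_divergence_def by (rule integral_cong_AE[OF _ _ ed]) measurable
  also have "\<dots> = (\<integral>x. f x * ln (f x) \<partial>\<beta>)"
    using f_nonneg by (subst integral_real_density) auto
  also have "\<dots> \<le> (\<integral>x. f x * g x \<partial>\<beta>)"
    by (intro integral_mono int_flnf int_fg ln_le)
  also have "\<dots> = (\<integral>x. g x \<partial>density \<beta> f)"
    using f_nonneg by (subst integral_real_density) auto
  finally show ?thesis using ac int by (simp add: D_KL_def)
qed

section \<open>Countable partitions of a probability space\<close>

text \<open>A function of a countable index is integrated by summing over the cells on which the index is
constant.\<close>
lemma nn_integral_countable_index:
  fixes i :: "'a \<Rightarrow> 'c::countable" and f :: "'c \<Rightarrow> ennreal"
  assumes [measurable]: "i \<in> M \<rightarrow>\<^sub>M count_space UNIV"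
  shows "(\<integral>\<^sup>+x. f (i x) \<partial>M) =
    (\<integral>\<^sup>+a. emeasure M (i -` {a} \<inter> space M) * f a \<partial>count_space UNIV)"
proof -
  define L where "L = distr M (count_space UNIV) i"
  have "L = density (count_space UNIV) (\<lambda>a. emeasure L {a})"
    by (rule measure_eqI_countable[where A = UNIV])
       (simp_all add: L_def emeasure_density nn_integral_indicator_singleton)
  then have "(\<integral>\<^sup>+a. f a \<partial>L) =
      (\<integral>\<^sup>+a. f a \<partial>density (count_space UNIV) (\<lambda>a. emeasure L {a}))"
    by (rule arg_cong)
  also have "\<dots> = (\<integral>\<^sup>+a. emeasure L {a} * f a \<partial>count_space UNIV)"
    by (rule nn_integral_density) simp_all
  finally have "(\<integral>\<^sup>+a. f a \<partial>L) = (\<integral>\<^sup>+a. emeasure L {a} * f a \<partial>count_space UNIV)" .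
  then show ?thesis by (simp add: L_def nn_integral_distr emeasure_distr)
qed

lemma AE_cell_nonnull:
  fixes i :: "'a \<Rightarrow> 'c::countable"
  assumes "prob_space M" and [measurable]: "i \<in> M \<rightarrow>\<^sub>M count_space UNIV"
  shows "AE x in M. 0 < measure M (i -` {i x} \<inter> space M)"
proof -
  interpret prob_space M by fact
  have "AE x in M. \<forall>a. measure M (i -` {a} \<inter> space M) = 0 \<longrightarrow> i x \<noteq> a"
  proof (rule AE_all_countable[THEN iffD2], rule allI)
    fix a
    show "AE x in M. measure M (i -` {a} \<inter> space M) = 0 \<longrightarrow> i x \<noteq> a"
    proof (cases "measure M (i -` {a} \<inter> space M) = 0")
      case True
      then have "AE x in M. x \<notin> i -` {a} \<inter> space M"
        by (intro AE_not_in) (auto simp: null_sets_def emeasure_eq_measure)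
      then show ?thesis using AE_space by eventually_elim auto
    qed simp
  qed
  then show ?thesis
    by eventually_elim (metis measure_nonneg order_less_le)
qed

text \<open>Gibbs' inequality: the Shannon entropy of the partition of \<open>N\<close> into the cells of \<open>j\<close> is at most
the cross entropy relative to any positive summable weight \<open>w\<close> on the cells, plus the total mass of
\<open>w\<close>. It comes from \<open>ln (w/n) \<le> w/n - 1\<close>, where \<open>n\<close> is the mass of the cell, since integrating
\<open>w/n\<close> sums \<open>w\<close> over the cells with \<open>n > 0\<close>.\<close>
lemma cell_entropy_le:
  fixes j :: "'b \<Rightarrow> 'c::countable" and w :: "'c \<Rightarrow> real"
  assumes "prob_space N" and [measurable]: "j \<in> N \<rightarrow>\<^sub>M count_space UNIV"
    and w_pos: "\<And>b. 0 < w b"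
    and w_sum: "(\<integral>\<^sup>+b. ennreal (w b) \<partial>count_space UNIV) \<le> ennreal S" and S: "0 \<le> S"
    and w_int: "integrable N (\<lambda>y. - ln (w (j y)))"
  defines "n \<equiv> \<lambda>b. measure N (j -` {b} \<inter> space N)"
  shows "integrable N (\<lambda>y. - ln (n (j y)))" (is ?int)
    and "(\<integral>y. - ln (n (j y)) \<partial>N) \<le> (\<integral>y. - ln (w (j y)) \<partial>N) + S" (is ?le)
proof -
  interpret prob_space N by fact
  have n_nonneg: "0 \<le> n b" and n_le: "n b \<le> 1" for b by (auto simp: n_def)
  have n_pos: "AE y in N. 0 < n (j y)"
    unfolding n_def by (rule AE_cell_nonnull) fact+
  have "(\<integral>\<^sup>+y. ennreal (w (j y) / n (j y)) \<partial>N) =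
      (\<integral>\<^sup>+b. ennreal (n b) * ennreal (w b / n b) \<partial>count_space UNIV)"
    by (subst nn_integral_countable_index[where i = j and f = "\<lambda>b. ennreal (w b / n b)"])
       (simp_all add: n_def emeasure_eq_measure)
  also have "\<dots> \<le> (\<integral>\<^sup>+b. ennreal (w b) \<partial>count_space UNIV)"
  proof (rule nn_integral_mono)
    fix b
    have "ennreal (n b) * ennreal (w b / n b) = ennreal (n b * (w b / n b))"
      using n_nonneg by (rule ennreal_mult'[symmetric])
    also have "\<dots> \<le> ennreal (w b)"
      using w_pos[of b] by (intro ennreal_leI) auto
    finally show "ennreal (n b) * ennreal (w b / n b) \<le> ennreal (w b)" .
  qed
  also note w_sum
  finally have wn: "(\<integral>\<^sup>+y. ennreal (w (j y) / n (j y)) \<partial>N) \<le> ennreal S" .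
  have wn_nonneg: "0 \<le> w b / n b" for b
    using w_pos[of b] n_nonneg[of b] by simp
  have wn_int: "integrable N (\<lambda>y. w (j y) / n (j y))"
    using wn wn_nonneg
    by (intro integrableI_nonneg) (auto simp: less_top[symmetric] top_unique)
  have wn_le: "(\<integral>y. w (j y) / n (j y) \<partial>N) \<le> S"
    using wn S wn_nonneg
    by (subst (asm) nn_integral_eq_integral[OF wn_int]) auto
  have ae: "AE y in N. 0 \<le> - ln (n (j y)) \<and>
      - ln (n (j y)) \<le> - ln (w (j y)) + w (j y) / n (j y)"
    using n_pos
  proof eventually_elim
    case (elim y)
    have "ln (w (j y) / n (j y)) \<le> w (j y) / n (j y) - 1"
      using elim w_pos by (intro ln_le_minus_one) auto
    then show ?case
      using elim n_le[of "j y"] w_pos[of "j y"] by (simp add: ln_div)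
  qed
  have dom_int: "integrable N (\<lambda>y. - ln (w (j y)) + w (j y) / n (j y))"
    using w_int wn_int by (rule Bochner_Integration.integrable_add)
  show ?int
    by (rule Bochner_Integration.integrable_bound[OF dom_int])
       (use ae in \<open>auto\<close>)
  then have "(\<integral>y. - ln (n (j y)) \<partial>N) \<le> (\<integral>y. - ln (w (j y)) + w (j y) / n (j y) \<partial>N)"
    using dom_int ae by (intro integral_mono_AE) auto
  also have "\<dots> = (\<integral>y. - ln (w (j y)) \<partial>N) + (\<integral>y. w (j y) / n (j y) \<partial>N)"
    by (rule Bochner_Integration.integral_add[OF w_int wn_int])
  finally show ?le using wn_le by simp
qed

section \<open>Block approximation of a coupling\<close>

lemma density_fst_marginal:
  assumes "sigma_finite_measure \<nu>" and [measurable]: "f \<in> borel_measurable (\<mu> \<Otimes>\<^sub>M \<nu>)"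
    and one: "AE x in \<mu>. (\<integral>\<^sup>+y. f (x, y) \<partial>\<nu>) = 1"
  shows "distr (density (\<mu> \<Otimes>\<^sub>M \<nu>) f) \<mu> fst = \<mu>"
proof (rule measure_eqI)
  interpret N: sigma_finite_measure \<nu> by fact
  fix A assume "A \<in> sets (distr (density (\<mu> \<Otimes>\<^sub>M \<nu>) f) \<mu> fst)"
  then have A[measurable]: "A \<in> sets \<mu>" by simp
  have "emeasure (distr (density (\<mu> \<Otimes>\<^sub>M \<nu>) f) \<mu> fst) A =
      (\<integral>\<^sup>+z. f z * indicator A (fst z) \<partial>(\<mu> \<Otimes>\<^sub>M \<nu>))"
    by (auto simp: emeasure_distr emeasure_density indicator_def intro!: nn_integral_cong)
  also have "\<dots> = (\<integral>\<^sup>+x. \<integral>\<^sup>+y. f (x, y) * indicator A x \<partial>\<nu> \<partial>\<mu>)"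
    by (subst N.nn_integral_fst[symmetric]) auto
  also have "\<dots> = (\<integral>\<^sup>+x. (\<integral>\<^sup>+y. f (x, y) \<partial>\<nu>) * indicator A x \<partial>\<mu>)"
    by (intro nn_integral_cong nn_integral_multc) measurable
  also have "\<dots> = (\<integral>\<^sup>+x. indicator A x \<partial>\<mu>)"
    using one by (intro nn_integral_cong_AE) auto
  also have "\<dots> = emeasure \<mu> A" by simp
  finally show "emeasure (distr (density (\<mu> \<Otimes>\<^sub>M \<nu>) f) \<mu> fst) A = emeasure \<mu> A" .
qed simp

lemma density_snd_marginal:
  assumes "sigma_finite_measure \<mu>" "sigma_finite_measure \<nu>"
    and [measurable]: "f \<in> borel_measurable (\<mu> \<Otimes>\<^sub>M \<nu>)"
    and one: "AE y in \<nu>. (\<integral>\<^sup>+x. f (x, y) \<partial>\<mu>) = 1"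
  shows "distr (density (\<mu> \<Otimes>\<^sub>M \<nu>) f) \<nu> snd = \<nu>"
proof (rule measure_eqI)
  interpret pair_sigma_finite \<mu> \<nu> using assms(1,2) by (rule pair_sigma_finite.intro)
  fix A assume "A \<in> sets (distr (density (\<mu> \<Otimes>\<^sub>M \<nu>) f) \<nu> snd)"
  then have A[measurable]: "A \<in> sets \<nu>" by simp
  have "emeasure (distr (density (\<mu> \<Otimes>\<^sub>M \<nu>) f) \<nu> snd) A =
      (\<integral>\<^sup>+z. f z * indicator A (snd z) \<partial>(\<mu> \<Otimes>\<^sub>M \<nu>))"
    by (auto simp: emeasure_distr emeasure_density indicator_def intro!: nn_integral_cong)
  also have "\<dots> = (\<integral>\<^sup>+y. \<integral>\<^sup>+x. f (x, y) * indicator A y \<partial>\<mu> \<partial>\<nu>)"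
    by (subst nn_integral_snd[symmetric]) auto
  also have "\<dots> = (\<integral>\<^sup>+y. (\<integral>\<^sup>+x. f (x, y) \<partial>\<mu>) * indicator A y \<partial>\<nu>)"
    by (intro nn_integral_cong nn_integral_multc) measurable
  also have "\<dots> = (\<integral>\<^sup>+y. indicator A y \<partial>\<nu>)"
    using one by (intro nn_integral_cong_AE) auto
  also have "\<dots> = emeasure \<nu> A" by simp
  finally show "emeasure (distr (density (\<mu> \<Otimes>\<^sub>M \<nu>) f) \<nu> snd) A = emeasure \<nu> A" .
qed simp

text \<open>A coupling \<open>\<pi>\<close> together with countable measurable partitions of both factors. The partitions are
given by the maps \<open>i\<close> and \<open>j\<close> that send a point to the index of its cell.\<close>
locale cell_coupling = M: prob_space \<mu> + N: prob_space \<nu>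
  for \<mu> :: "'a measure" and \<nu> :: "'b measure" +
  fixes \<pi> :: "('a \<times> 'b) measure" and i :: "'a \<Rightarrow> 'c::countable" and j :: "'b \<Rightarrow> 'd::countable"
  assumes coupling: "\<pi> \<in> couplings \<mu> \<nu>"
    and i_meas [measurable]: "i \<in> \<mu> \<rightarrow>\<^sub>M count_space UNIV"
    and j_meas [measurable]: "j \<in> \<nu> \<rightarrow>\<^sub>M count_space UNIV"
begin

text \<open>The \<open>\<mu>\<close>-mass of the cell with index \<open>a\<close>.\<close>
definition fst_mass :: "'c \<Rightarrow> real" where
  "fst_mass a = measure \<mu> (i -` {a} \<inter> space \<mu>)"

text \<open>The \<open>\<nu>\<close>-mass of the cell with index \<open>b\<close>.\<close>
definition snd_mass :: "'d \<Rightarrow> real" where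
  "snd_mass b = measure \<nu> (j -` {b} \<inter> space \<nu>)"

text \<open>The product cell with indices \<open>a\<close> and \<open>b\<close>.\<close>
definition cell :: "'c \<Rightarrow> 'd \<Rightarrow> ('a \<times> 'b) set" where
  "cell a b = (i -` {a} \<inter> space \<mu>) \<times> (j -` {b} \<inter> space \<nu>)"

text \<open>The density that is constant on product cells and makes the mass of each of them equal to its
\<open>\<pi>\<close>-mass. On cells with \<open>fst_mass a * snd_mass b = 0\<close> division by zero makes it \<open>0\<close>, which is
harmless because \<open>\<pi>\<close> does not charge these cells.\<close>
definition block_density :: "'a \<times> 'b \<Rightarrow> real" where
  "block_density = (\<lambda>(x, y).
     measure \<pi> (cell (i x) (j y)) / (fst_mass (i x) * snd_mass (j y)))"

text \<open>The block approximation of \<open>\<pi>\<close>: conditionally on the product cell, the two coordinates are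
independent and distributed as under \<open>\<mu>\<close> and \<open>\<nu>\<close>.\<close>
definition block_coupling :: "('a \<times> 'b) measure" where
  "block_coupling = density (\<mu> \<Otimes>\<^sub>M \<nu>) (\<lambda>z. ennreal (block_density z))"

sublocale P: prob_space \<pi>
  using coupling by (simp add: couplings_def)

lemma sets_coupling [measurable_cong]: "sets \<pi> = sets (\<mu> \<Otimes>\<^sub>M \<nu>)"
  using coupling by (simp add: couplings_def)

lemma space_coupling: "space \<pi> = space \<mu> \<times> space \<nu>"
  using sets_eq_imp_space_eq[OF sets_coupling] by (simp add: space_pair_measure)

lemma sets_cell [measurable]: "cell a b \<in> sets (\<mu> \<Otimes>\<^sub>M \<nu>)"
  unfolding cell_def by measurable

lemma fst_mass_cells:
  "(\<integral>\<^sup>+b. ennreal (measure \<pi> (cell a b)) \<partial>count_space UNIV) = ennreal (fst_mass a)"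
proof -
  have "(\<integral>\<^sup>+b. ennreal (measure \<pi> (cell a b)) \<partial>count_space UNIV) = emeasure \<pi> (\<Union>b. cell a b)"
    by (subst emeasure_UN_countable)
       (auto simp: disjoint_family_on_def cell_def P.emeasure_eq_measure sets_coupling)
  also have "(\<Union>b. cell a b) = fst -` (i -` {a} \<inter> space \<mu>) \<inter> space \<pi>"
    by (auto simp: cell_def space_coupling)
  also have "emeasure \<pi> \<dots> = emeasure (distr \<pi> \<mu> fst) (i -` {a} \<inter> space \<mu>)"
    by (subst emeasure_distr) auto
  also have "distr \<pi> \<mu> fst = \<mu>"
    using coupling by (simp add: couplings_def)
  finally show ?thesis by (simp add: fst_mass_def M.emeasure_eq_measure)
qed

lemma snd_mass_cells:
  "(\<integral>\<^sup>+a. ennreal (measure \<pi> (cell a b)) \<partial>count_space UNIV) = ennreal (snd_mass b)"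
proof -
  have "(\<integral>\<^sup>+a. ennreal (measure \<pi> (cell a b)) \<partial>count_space UNIV) = emeasure \<pi> (\<Union>a. cell a b)"
    by (subst emeasure_UN_countable)
       (auto simp: disjoint_family_on_def cell_def P.emeasure_eq_measure sets_coupling)
  also have "(\<Union>a. cell a b) = snd -` (j -` {b} \<inter> space \<nu>) \<inter> space \<pi>"
    by (auto simp: cell_def space_coupling)
  also have "emeasure \<pi> \<dots> = emeasure (distr \<pi> \<nu> snd) (j -` {b} \<inter> space \<nu>)"
    by (subst emeasure_distr) auto
  also have "distr \<pi> \<nu> snd = \<nu>"
    using coupling by (simp add: couplings_def)
  finally show ?thesis by (simp add: snd_mass_def N.emeasure_eq_measure)
qed

lemma cell_le_fst_mass: "measure \<pi> (cell a b) \<le> fst_mass a"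
proof -
  have "ennreal (measure \<pi> (cell a b)) \<le>
      (\<integral>\<^sup>+b. ennreal (measure \<pi> (cell a b)) \<partial>count_space UNIV)"
    by (rule nn_integral_ge_point) simp
  then show ?thesis by (simp add: fst_mass_cells fst_mass_def)
qed

lemma cell_le_snd_mass: "measure \<pi> (cell a b) \<le> snd_mass b"
proof -
  have "ennreal (measure \<pi> (cell a b)) \<le>
      (\<integral>\<^sup>+a. ennreal (measure \<pi> (cell a b)) \<partial>count_space UNIV)"
    by (rule nn_integral_ge_point) simp
  then show ?thesis by (simp add: snd_mass_cells snd_mass_def)
qed

lemma mass_nonneg [simp]: "0 \<le> fst_mass a" "0 \<le> snd_mass b"
  by (simp_all add: fst_mass_def snd_mass_def)

lemma block_density_nonneg: "0 \<le> block_density z"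
  by (simp add: block_density_def split: prod.split)

lemma measurable_index [measurable]:
  "(\<lambda>z. (i (fst z), j (snd z))) \<in> \<mu> \<Otimes>\<^sub>M \<nu> \<rightarrow>\<^sub>M count_space UNIV"
proof -
  have "(\<lambda>z. (i (fst z), j (snd z))) \<in>
      \<mu> \<Otimes>\<^sub>M \<nu> \<rightarrow>\<^sub>M (count_space UNIV :: 'c measure) \<Otimes>\<^sub>M (count_space UNIV :: 'd measure)"
    by measurable
  then show ?thesis by (simp add: pair_measure_countable)
qed

lemma borel_measurable_block_density [measurable]:
  "block_density \<in> borel_measurable (\<mu> \<Otimes>\<^sub>M \<nu>)"
proof -
  have "(\<lambda>(a, b). measure \<pi> (cell a b) / (fst_mass a * snd_mass b)) \<circ>
      (\<lambda>z. (i (fst z), j (snd z))) \<in> borel_measurable (\<mu> \<Otimes>\<^sub>M \<nu>)"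
    by (rule measurable_comp[OF measurable_index]) simp
  then show ?thesis
    by (simp add: block_density_def comp_def case_prod_beta)
qed

lemma nn_integral_block_density_snd:
  "AE x in \<mu>. (\<integral>\<^sup>+y. ennreal (block_density (x, y)) \<partial>\<nu>) = 1"
  using AE_cell_nonnull[OF M.prob_space_axioms i_meas]
proof eventually_elim
  case (elim x)
  then have pos: "0 < fst_mass (i x)" by (simp add: fst_mass_def)
  define a where "a = i x"
  have "(\<integral>\<^sup>+y. ennreal (block_density (x, y)) \<partial>\<nu>) =
      (\<integral>\<^sup>+b. ennreal (snd_mass b) *
        ennreal (measure \<pi> (cell a b) / (fst_mass a * snd_mass b)) \<partial>count_space UNIV)"
    unfolding block_density_def a_def
    by (subst nn_integral_countable_index[OF j_meas, symmetric,
          unfolded N.emeasure_eq_measure, folded snd_mass_def]) simp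
  also have "\<dots> = (\<integral>\<^sup>+b. ennreal (1 / fst_mass a) * ennreal (measure \<pi> (cell a b))
      \<partial>count_space UNIV)"
  proof (rule nn_integral_cong)
    fix b
    have "snd_mass b = 0 \<Longrightarrow> measure \<pi> (cell a b) = 0"
      using cell_le_snd_mass[of a b] measure_nonneg[of \<pi> "cell a b"] by simp
    then have "snd_mass b * (measure \<pi> (cell a b) / (fst_mass a * snd_mass b)) =
        1 / fst_mass a * measure \<pi> (cell a b)"
      by (cases "snd_mass b = 0") auto
    then show "ennreal (snd_mass b) * ennreal (measure \<pi> (cell a b) / (fst_mass a * snd_mass b)) =
        ennreal (1 / fst_mass a) * ennreal (measure \<pi> (cell a b))"
      by (simp flip: ennreal_mult' ennreal_mult'')
  qed
  also have "\<dots> = ennreal (1 / fst_mass a) * ennreal (fst_mass a)"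
    by (subst nn_integral_cmult) (simp_all add: fst_mass_cells)
  also have "\<dots> = 1" using pos by (simp add: a_def flip: ennreal_mult')
  finally show ?case .
qed

lemma nn_integral_block_density_fst:
  "AE y in \<nu>. (\<integral>\<^sup>+x. ennreal (block_density (x, y)) \<partial>\<mu>) = 1"
  using AE_cell_nonnull[OF N.prob_space_axioms j_meas]
proof eventually_elim
  case (elim y)
  then have pos: "0 < snd_mass (j y)" by (simp add: snd_mass_def)
  define b where "b = j y"
  have "(\<integral>\<^sup>+x. ennreal (block_density (x, y)) \<partial>\<mu>) =
      (\<integral>\<^sup>+a. ennreal (fst_mass a) *
        ennreal (measure \<pi> (cell a b) / (fst_mass a * snd_mass b)) \<partial>count_space UNIV)"
    unfolding block_density_def b_def
    by (subst nn_integral_countable_index[OF i_meas, symmetric,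
          unfolded M.emeasure_eq_measure, folded fst_mass_def]) simp
  also have "\<dots> = (\<integral>\<^sup>+a. ennreal (1 / snd_mass b) * ennreal (measure \<pi> (cell a b))
      \<partial>count_space UNIV)"
  proof (rule nn_integral_cong)
    fix a
    have "fst_mass a = 0 \<Longrightarrow> measure \<pi> (cell a b) = 0"
      using cell_le_fst_mass[of a b] measure_nonneg[of \<pi> "cell a b"] by simp
    then have "fst_mass a * (measure \<pi> (cell a b) / (fst_mass a * snd_mass b)) =
        1 / snd_mass b * measure \<pi> (cell a b)"
      by (cases "fst_mass a = 0") auto
    then show "ennreal (fst_mass a) * ennreal (measure \<pi> (cell a b) / (fst_mass a * snd_mass b)) =
        ennreal (1 / snd_mass b) * ennreal (measure \<pi> (cell a b))"
      by (simp flip: ennreal_mult' ennreal_mult'')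
  qed
  also have "\<dots> = ennreal (1 / snd_mass b) * ennreal (snd_mass b)"
    by (subst nn_integral_cmult) (simp_all add: snd_mass_cells)
  also have "\<dots> = 1" using pos by (simp add: b_def flip: ennreal_mult')
  finally show ?case .
qed

lemma block_coupling_marginals:
  "distr block_coupling \<mu> fst = \<mu>" "distr block_coupling \<nu> snd = \<nu>"
  unfolding block_coupling_def
  by (intro density_fst_marginal density_snd_marginal nn_integral_block_density_snd
      nn_integral_block_density_fst M.sigma_finite_measure_axioms N.sigma_finite_measure_axioms;
      measurable)+

lemma sets_block_coupling [measurable_cong]: "sets block_coupling = sets (\<mu> \<Otimes>\<^sub>M \<nu>)"
  by (simp add: block_coupling_def)

lemma block_coupling_in_couplings: "block_coupling \<in> couplings \<mu> \<nu>"
proof -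
  have "prob_space (distr block_coupling \<mu> fst)"
    using M.prob_space_axioms by (simp add: block_coupling_marginals)
  then have "prob_space block_coupling"
    by (rule prob_space_distrD[rotated]) measurable
  then show ?thesis
    by (simp add: couplings_def block_coupling_marginals sets_block_coupling)
qed

lemma emeasure_block_coupling_cell: "emeasure block_coupling (cell a b) = emeasure \<pi> (cell a b)"
proof -
  let ?c = "measure \<pi> (cell a b) / (fst_mass a * snd_mass b)"
  have "emeasure block_coupling (cell a b) =
      (\<integral>\<^sup>+z. ennreal ?c * indicator (cell a b) z \<partial>(\<mu> \<Otimes>\<^sub>M \<nu>))"
    unfolding block_coupling_def
    by (subst emeasure_density)
       (measurable, auto intro!: nn_integral_cong simp: block_density_def cell_def
          split: split_indicator)
  also have "\<dots> = ennreal ?c * emeasure (\<mu> \<Otimes>\<^sub>M \<nu>) (cell a b)"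
    by (rule nn_integral_cmult_indicator) measurable
  also have "emeasure (\<mu> \<Otimes>\<^sub>M \<nu>) (cell a b) = ennreal (fst_mass a * snd_mass b)"
    unfolding cell_def
    by (subst N.emeasure_pair_measure_Times)
       (auto simp: fst_mass_def snd_mass_def M.emeasure_eq_measure N.emeasure_eq_measure
          ennreal_mult')
  also have "ennreal ?c * \<dots> = ennreal (?c * (fst_mass a * snd_mass b))"
    by (rule ennreal_mult'[symmetric]) simp
  also have "?c * (fst_mass a * snd_mass b) = measure \<pi> (cell a b)"
    using cell_le_fst_mass[of a b] cell_le_snd_mass[of a b] measure_nonneg[of \<pi> "cell a b"]
    by (cases "fst_mass a = 0 \<or> snd_mass b = 0") (auto intro: antisym)
  finally show ?thesis by (simp add: P.emeasure_eq_measure)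
qed

text \<open>The block approximation and \<open>\<pi>\<close> have the same joint law of cell indices.\<close>
lemma distr_block_coupling_index:
  "distr block_coupling (count_space UNIV) (\<lambda>z. (i (fst z), j (snd z))) =
    distr \<pi> (count_space UNIV) (\<lambda>z. (i (fst z), j (snd z)))"
proof (rule measure_eqI_countable[where A = UNIV])
  fix c :: "'c \<times> 'd"
  obtain a b where c: "c = (a, b)" by fastforce
  have eq: "emeasure (distr Q (count_space UNIV) (\<lambda>z. (i (fst z), j (snd z)))) {c} =
      emeasure Q (cell a b)" if [measurable_cong]: "sets Q = sets (\<mu> \<Otimes>\<^sub>M \<nu>)" for Q
  proof -
    have "(\<lambda>z. (i (fst z), j (snd z))) -` {c} \<inter> space Q = cell a b"
      using sets_eq_imp_space_eq[OF that] by (auto simp: c cell_def space_pair_measure)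
    then show ?thesis by (subst emeasure_distr) auto
  qed
  show "emeasure (distr block_coupling (count_space UNIV) (\<lambda>z. (i (fst z), j (snd z)))) {c} =
      emeasure (distr \<pi> (count_space UNIV) (\<lambda>z. (i (fst z), j (snd z)))) {c}"
    by (simp add: eq sets_block_coupling sets_coupling emeasure_block_coupling_cell)
qed simp_all

text \<open>The entropy of only one of the two partitions is needed, since the density is at most the inverse
of either marginal mass.\<close>
lemma D_KL_block_coupling_le:
  assumes int: "integrable \<nu> (\<lambda>y. - ln (snd_mass (j y)))"
  shows "D_KL block_coupling (\<mu> \<Otimes>\<^sub>M \<nu>) \<le> ereal (\<integral>y. - ln (snd_mass (j y)) \<partial>\<nu>)"
proof -
  interpret MN: pair_prob_space \<mu> \<nu> ..
  have [measurable]: "(\<lambda>y. - ln (snd_mass (j y))) \<in> borel_measurable \<nu>"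
    using int by (rule borel_measurable_integrable)
  have le: "block_density z \<le> exp (- ln (snd_mass (j (snd z))))" for z
  proof (cases "snd_mass (j (snd z)) = 0 \<or> fst_mass (i (fst z)) = 0")
    case True
    then show ?thesis by (auto simp: block_density_def case_prod_beta)
  next
    case False
    let ?m = "fst_mass (i (fst z))" and ?n = "snd_mass (j (snd z))"
    from False have pos: "0 < ?m" "0 < ?n"
      using mass_nonneg(1)[of "i (fst z)"] mass_nonneg(2)[of "j (snd z)"]
      by (simp_all add: order_less_le)
    have "block_density z = measure \<pi> (cell (i (fst z)) (j (snd z))) / (?m * ?n)"
      by (simp add: block_density_def case_prod_beta)
    also have "\<dots> \<le> ?m / (?m * ?n)"
      using pos by (intro divide_right_mono cell_le_fst_mass) auto
    also have "\<dots> = exp (- ln ?n)" using pos by (simp add: exp_minus divide_inverse)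
    finally show ?thesis .
  qed
  have int': "integrable (distr block_coupling \<nu> snd) (\<lambda>y. - ln (snd_mass (j y)))"
    using int by (simp add: block_coupling_marginals)
  then have int'': "integrable block_coupling (\<lambda>z. - ln (snd_mass (j (snd z))))"
    by (subst (asm) integrable_distr_eq) auto
  have "D_KL block_coupling (\<mu> \<Otimes>\<^sub>M \<nu>) \<le>
      ereal (\<integral>z. - ln (snd_mass (j (snd z))) \<partial>block_coupling)"
    unfolding block_coupling_def
  proof (rule D_KL_density_le)
    show "0 \<le> - ln (snd_mass (j (snd z)))" for z
      using mass_nonneg(2)[of "j (snd z)"] N.prob_le_1
      by (cases "snd_mass (j (snd z)) = 0") (simp_all add: snd_mass_def order_less_le)
  qed (use int'' in \<open>auto simp: block_coupling_def[symmetric] block_density_nonneg le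
         MN.P.prob_space_axioms\<close>)
  also have "(\<integral>z. - ln (snd_mass (j (snd z))) \<partial>block_coupling) =
      (\<integral>y. - ln (snd_mass (j y)) \<partial>distr block_coupling \<nu> snd)"
    by (rule integral_distr[symmetric]) auto
  finally show ?thesis by (simp add: block_coupling_marginals)
qed

end

section \<open>Stability of the transport cost\<close>

text \<open>The cost \<open>(s\<^sup>2 - t\<^sup>2)\<^sup>2\<close> is a polynomial of degree four in the two distances, so it changes by
at most a multiple of \<open>\<eta>\<close> times a cubic polynomial when the distances move by \<open>2 \<eta>\<close>. The cubic is
relaxed to a quartic because the assumption is on fourth moments.\<close>
lemma sq_diff_sq_lipschitz:
  fixes s t s' t' \<eta> D :: real
  assumes nonneg: "0 \<le> s" "0 \<le> t" and s': "\<bar>s' - s\<bar> \<le> 2 * \<eta>" and t': "\<bar>t' - t\<bar> \<le> 2 * \<eta>"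
    and \<eta>: "\<eta> \<le> D" and D: "1 \<le> D"
  shows "\<bar>(s'\<^sup>2 - t'\<^sup>2)\<^sup>2 - (s\<^sup>2 - t\<^sup>2)\<^sup>2\<bar> \<le> 3456 * D ^ 3 * \<eta> * (1 + s ^ 4 + t ^ 4)"
proof -
  define r where "r = 1 + s + t"
  have r: "1 \<le> r" using nonneg by (simp add: r_def)
  have \<eta>0: "0 \<le> \<eta>" using s' abs_ge_zero[of "s' - s"] by linarith
  have sq: "\<bar>a'\<^sup>2 - a\<^sup>2\<bar> \<le> 2 * \<eta> * (2 * a + 2 * D)" "a'\<^sup>2 \<le> 2 * a\<^sup>2 + 8 * D\<^sup>2"
    if "0 \<le> a" "\<bar>a' - a\<bar> \<le> 2 * \<eta>" for a a' :: real
  proof -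
    have "a'\<^sup>2 - a\<^sup>2 = (a' - a) * (2 * a + (a' - a))" by (simp add: power2_eq_square algebra_simps)
    also have "\<bar>\<dots>\<bar> = \<bar>a' - a\<bar> * \<bar>2 * a + (a' - a)\<bar>" by (rule abs_mult)
    also have "\<dots> \<le> (2 * \<eta>) * (2 * a + 2 * D)"
      using that \<eta> \<eta>0 by (intro mult_mono) auto
    finally show "\<bar>a'\<^sup>2 - a\<^sup>2\<bar> \<le> 2 * \<eta> * (2 * a + 2 * D)" .
    have "\<bar>a'\<bar> \<le> \<bar>a + 2 * D\<bar>" using that \<eta> by linarith
    then have "a'\<^sup>2 \<le> (a + 2 * D)\<^sup>2" by (simp add: abs_le_square_iff)
    also have "\<dots> \<le> 2 * a\<^sup>2 + 8 * D\<^sup>2"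
      using zero_le_power2[of "a - 2 * D"] by (simp add: power2_eq_square algebra_simps)
    finally show "a'\<^sup>2 \<le> 2 * a\<^sup>2 + 8 * D\<^sup>2" .
  qed
  have "\<bar>(s'\<^sup>2 - s\<^sup>2) - (t'\<^sup>2 - t\<^sup>2)\<bar> \<le> 4 * \<eta> * (s + t + 2 * D)"
    using sq(1)[OF nonneg(1) s'] sq(1)[OF nonneg(2) t']
      abs_triangle_ineq4[of "s'\<^sup>2 - s\<^sup>2" "t'\<^sup>2 - t\<^sup>2"]
    by (simp add: algebra_simps)
  also have "\<dots> \<le> 4 * \<eta> * (2 * D * r)"
  proof -
    have "1 * s \<le> (2 * D) * s" "1 * t \<le> (2 * D) * t"
      using nonneg D by (intro mult_right_mono; simp)+
    then show ?thesis using \<eta>0 by (intro mult_left_mono) (auto simp: r_def algebra_simps)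
  qed
  finally have A: "\<bar>(s'\<^sup>2 - s\<^sup>2) - (t'\<^sup>2 - t\<^sup>2)\<bar> \<le> 8 * D * \<eta> * r" by (simp add: algebra_simps)
  have "\<bar>(s'\<^sup>2 - t'\<^sup>2) + (s\<^sup>2 - t\<^sup>2)\<bar> \<le> (s'\<^sup>2 + t'\<^sup>2) + (s\<^sup>2 + t\<^sup>2)"
    using zero_le_power2[of s] zero_le_power2[of t] zero_le_power2[of s'] zero_le_power2[of t']
    unfolding abs_le_iff by linarith
  also have "\<dots> \<le> 3 * (s\<^sup>2 + t\<^sup>2) + 16 * D\<^sup>2"
    using sq(2)[OF nonneg(1) s'] sq(2)[OF nonneg(2) t'] by simp
  also have "\<dots> \<le> 16 * D\<^sup>2 * r\<^sup>2"
  proof -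
    have "1 \<le> D\<^sup>2" using D by (simp add: one_le_power)
    then have "3 * (s\<^sup>2 + t\<^sup>2) \<le> 16 * D\<^sup>2 * (s\<^sup>2 + t\<^sup>2)" by (intro mult_right_mono) auto
    moreover have "1 + (s\<^sup>2 + t\<^sup>2) \<le> r\<^sup>2"
      using nonneg mult_nonneg_nonneg[OF nonneg]
      by (simp add: r_def power2_eq_square algebra_simps)
    then have "16 * D\<^sup>2 * (1 + (s\<^sup>2 + t\<^sup>2)) \<le> 16 * D\<^sup>2 * r\<^sup>2" by (intro mult_left_mono) auto
    ultimately show ?thesis by (simp add: algebra_simps)
  qed
  finally have B: "\<bar>(s'\<^sup>2 - t'\<^sup>2) + (s\<^sup>2 - t\<^sup>2)\<bar> \<le> 16 * D\<^sup>2 * r\<^sup>2" .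
  have R: "r ^ 3 \<le> 27 * (1 + s ^ 4 + t ^ 4)"
  proof -
    have "r\<^sup>2 \<le> 3 * (1 + s\<^sup>2 + t\<^sup>2)"
      using zero_le_power2[of "s - t"] zero_le_power2[of "s - 1"] zero_le_power2[of "t - 1"]
      by (simp add: r_def power2_eq_square algebra_simps)
    then have "(r\<^sup>2)\<^sup>2 \<le> (3 * (1 + s\<^sup>2 + t\<^sup>2))\<^sup>2" by (intro power_mono) auto
    also have "\<dots> \<le> 27 * (1 + s ^ 4 + t ^ 4)"
      using zero_le_power2[of "s\<^sup>2 - t\<^sup>2"] zero_le_power2[of "s\<^sup>2 - 1"] zero_le_power2[of "t\<^sup>2 - 1"]
      by (simp add: power2_eq_square power4_eq_xxxx algebra_simps)
    finally have "r ^ 4 \<le> 27 * (1 + s ^ 4 + t ^ 4)" by simp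
    moreover have "r ^ 3 \<le> r ^ 4" using r by (intro power_increasing) auto
    ultimately show ?thesis by linarith
  qed
  \<comment> \<open>A difference of squares: the first factor is \<open>O(\<eta>)\<close>, the second grows quadratically.\<close>
  have "(s'\<^sup>2 - t'\<^sup>2)\<^sup>2 - (s\<^sup>2 - t\<^sup>2)\<^sup>2 =
      ((s'\<^sup>2 - s\<^sup>2) - (t'\<^sup>2 - t\<^sup>2)) * ((s'\<^sup>2 - t'\<^sup>2) + (s\<^sup>2 - t\<^sup>2))"
    by (simp add: power2_eq_square algebra_simps)
  also have "\<bar>\<dots>\<bar> \<le> (8 * D * \<eta> * r) * (16 * D\<^sup>2 * r\<^sup>2)"
    unfolding abs_mult using A B r D \<eta>0 by (intro mult_mono) auto
  also have "\<dots> = 128 * D ^ 3 * \<eta> * r ^ 3" by (simp add: power2_eq_square power3_eq_cube)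
  also have "\<dots> \<le> 128 * D ^ 3 * \<eta> * (27 * (1 + s ^ 4 + t ^ 4))"
    using R D \<eta>0 by (intro mult_left_mono) auto
  finally show ?thesis by (simp add: algebra_simps)
qed

text \<open>The integrand of the Gromov-Wasserstein cost at a pair of points of the product space.\<close>
definition gw_gap :: "('a::real_normed_vector \<times> 'b::real_normed_vector) \<times> 'a \<times> 'b \<Rightarrow> real" where
  "gw_gap z = ((norm (fst (fst z) - fst (snd z)))\<^sup>2 - (norm (snd (fst z) - snd (snd z)))\<^sup>2)\<^sup>2"

text \<open>A majorant of \<open>1 + \<parallel>x - x'\<parallel>^4 + \<parallel>y - y'\<parallel>^4\<close> that is a sum of functions of single points, so
that its integral involves only the fourth moments of the marginals.\<close>
definition quartic_growth :: "('a::real_normed_vector \<times> 'b::real_normed_vector) \<times> 'a \<times> 'b \<Rightarrow> real"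
  where "quartic_growth z =
    1 + (8 * norm (fst (fst z)) ^ 4 + 8 * norm (snd (fst z)) ^ 4 +
      (8 * norm (fst (snd z)) ^ 4 + 8 * norm (snd (snd z)) ^ 4))"

lemma gw_cost_eq: "gw_cost \<pi> = enn2ereal (\<integral>\<^sup>+z. ennreal (gw_gap z) \<partial>(\<pi> \<Otimes>\<^sub>M \<pi>))"
  unfolding gw_cost_def gw_gap_def
  by (rule arg_cong[where f = enn2ereal], rule nn_integral_cong) (simp add: case_prod_beta)

lemma gw_gap_nonneg: "0 \<le> gw_gap z" by (simp add: gw_gap_def)

lemma quartic_growth_nonneg: "0 \<le> quartic_growth z"
  by (simp add: quartic_growth_def)

lemma norm_diff_power4_le: "norm (x - y) ^ 4 \<le> 8 * norm x ^ 4 + 8 * norm y ^ 4"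
  for x y :: "'a::real_normed_vector"
proof -
  have "(norm (x - y))\<^sup>2 \<le> (norm x + norm y)\<^sup>2"
    by (intro power_mono norm_triangle_ineq4) simp
  also have "\<dots> \<le> 2 * ((norm x)\<^sup>2 + (norm y)\<^sup>2)"
    using zero_le_power2[of "norm x - norm y"] by (simp add: power2_eq_square algebra_simps)
  finally have "((norm (x - y))\<^sup>2)\<^sup>2 \<le> (2 * ((norm x)\<^sup>2 + (norm y)\<^sup>2))\<^sup>2"
    by (intro power_mono) simp_all
  also have "\<dots> \<le> 8 * norm x ^ 4 + 8 * norm y ^ 4"
    using zero_le_power2[of "(norm x)\<^sup>2 - (norm y)\<^sup>2"]
    by (simp add: power2_eq_square power4_eq_xxxx algebra_simps)
  finally show ?thesis by simp
qed

lemma quartic_growth_ge: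
  "1 + norm (fst (fst z) - fst (snd z)) ^ 4 + norm (snd (fst z) - snd (snd z)) ^ 4
    \<le> quartic_growth z"
  using norm_diff_power4_le[of "fst (fst z)" "fst (snd z)"]
    norm_diff_power4_le[of "snd (fst z)" "snd (snd z)"]
  by (simp add: quartic_growth_def)

lemma gw_gap_le_growth: "gw_gap z \<le> quartic_growth z"
proof -
  have "(a\<^sup>2 - b\<^sup>2)\<^sup>2 \<le> 1 + a ^ 4 + b ^ 4" for a b :: real
    using zero_le_power2[of "a * b"] by (simp add: power2_eq_square power4_eq_xxxx algebra_simps)
  from order_trans[OF this quartic_growth_ge] show ?thesis by (simp add: gw_gap_def)
qed

lemma gw_gap_perturb:
  assumes u: "\<And>x. norm (u x - x) \<le> \<eta>" and v: "\<And>y. norm (v y - y) \<le> \<eta>"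
    and \<eta>: "\<eta> \<le> D" and D: "1 \<le> D"
  shows "\<bar>gw_gap (map_prod u v (fst z), map_prod u v (snd z)) - gw_gap z\<bar>
    \<le> 3456 * D ^ 3 * \<eta> * quartic_growth z"
proof -
  have close: "\<bar>norm (f x - f x') - norm (x - x')\<bar> \<le> 2 * \<eta>" if "\<And>x. norm (f x - x) \<le> \<eta>"
    for f :: "'c::real_normed_vector \<Rightarrow> 'c" and x x'
  proof -
    have "\<bar>norm (f x - f x') - norm (x - x')\<bar> \<le> norm ((f x - f x') - (x - x'))"
      by (rule norm_triangle_ineq3)
    also have "(f x - f x') - (x - x') = (f x - x) - (f x' - x')" by simp
    also have "norm \<dots> \<le> norm (f x - x) + norm (f x' - x')" by (rule norm_triangle_ineq4)
    also have "\<dots> \<le> 2 * \<eta>" using that[of x] that[of x'] by simp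
    finally show ?thesis .
  qed
  have \<eta>0: "0 \<le> \<eta>" using norm_ge_zero u[of undefined] by (rule order_trans)
  have "\<bar>gw_gap (map_prod u v (fst z), map_prod u v (snd z)) - gw_gap z\<bar> \<le>
      3456 * D ^ 3 * \<eta> *
        (1 + norm (fst (fst z) - fst (snd z)) ^ 4 + norm (snd (fst z) - snd (snd z)) ^ 4)"
    unfolding gw_gap_def fst_conv snd_conv fst_map_prod snd_map_prod
    using close[OF u] close[OF v] \<eta> D by (intro sq_diff_sq_lipschitz) auto
  also have "\<dots> \<le> 3456 * D ^ 3 * \<eta> * quartic_growth z"
    using \<eta>0 D by (intro mult_left_mono quartic_growth_ge) auto
  finally show ?thesis .
qed

context
  fixes \<mu> :: "'a::euclidean_space measure" and \<nu> :: "'b::euclidean_space measure"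
    and \<pi> :: "('a \<times> 'b) measure"
  assumes \<mu>: "\<mu> \<in> P4" and \<nu>: "\<nu> \<in> P4" and \<pi>: "\<pi> \<in> couplings \<mu> \<nu>"
begin

interpretation P: prob_space \<pi>
  using \<pi> by (simp add: couplings_def)

lemma sets_coupling_borel [measurable_cong]: "sets \<pi> = sets (borel \<Otimes>\<^sub>M borel)"
  using \<pi> \<mu> \<nu> by (auto simp: couplings_def P4_def cong: sets_pair_measure_cong)

lemma borel_measurable_gw_gap [measurable]: "gw_gap \<in> borel_measurable (\<pi> \<Otimes>\<^sub>M \<pi>)"
  unfolding gw_gap_def[abs_def] by measurable

lemma borel_measurable_quartic_growth [measurable]:
  "quartic_growth \<in> borel_measurable (\<pi> \<Otimes>\<^sub>M \<pi>)"
  unfolding quartic_growth_def[abs_def] by measurable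

lemma nn_integral_quartic_growth:
  "(\<integral>\<^sup>+z. ennreal (quartic_growth z) \<partial>(\<pi> \<Otimes>\<^sub>M \<pi>)) = ennreal (1 + 16 * M4 \<mu> + 16 * M4 \<nu>)"
proof -
  interpret PP: pair_prob_space \<pi> \<pi> ..
  have int_\<mu>: "integrable \<mu> (\<lambda>x. norm x ^ 4)" and int_\<nu>: "integrable \<nu> (\<lambda>y. norm y ^ 4)"
    using \<mu> \<nu> by (auto simp: P4_def)
  have sets: "sets \<mu> = sets borel" "sets \<nu> = sets borel"
    using \<mu> \<nu> by (auto simp: P4_def)
  note [measurable_cong] = sets
  have M4_nonneg: "0 \<le> M4 \<mu>" "0 \<le> M4 \<nu>" by (auto simp: M4_def)
  let ?f = "\<lambda>p::'a \<times> 'b. 8 * norm (fst p) ^ 4 + 8 * norm (snd p) ^ 4"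
  have "(\<integral>\<^sup>+p. ennreal (norm (fst p) ^ 4) \<partial>\<pi>) = (\<integral>\<^sup>+x. ennreal (norm x ^ 4) \<partial>distr \<pi> \<mu> fst)"
    by (rule nn_integral_distr[symmetric]) measurable
  also have "\<dots> = ennreal (M4 \<mu>)"
    using \<pi> int_\<mu> by (simp add: couplings_def M4_def nn_integral_eq_integral)
  finally have f1: "(\<integral>\<^sup>+p. ennreal (norm (fst p) ^ 4) \<partial>\<pi>) = ennreal (M4 \<mu>)" .
  have "(\<integral>\<^sup>+p. ennreal (norm (snd p) ^ 4) \<partial>\<pi>) = (\<integral>\<^sup>+y. ennreal (norm y ^ 4) \<partial>distr \<pi> \<nu> snd)"
    by (rule nn_integral_distr[symmetric]) measurable
  also have "\<dots> = ennreal (M4 \<nu>)"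
    using \<pi> int_\<nu> by (simp add: couplings_def M4_def nn_integral_eq_integral)
  finally have f2: "(\<integral>\<^sup>+p. ennreal (norm (snd p) ^ 4) \<partial>\<pi>) = ennreal (M4 \<nu>)" .
  have "(\<integral>\<^sup>+p. ennreal (?f p) \<partial>\<pi>) =
      (\<integral>\<^sup>+p. ennreal 8 * ennreal (norm (fst p) ^ 4) + ennreal 8 * ennreal (norm (snd p) ^ 4) \<partial>\<pi>)"
    by (intro nn_integral_cong) (simp only: ennreal_plus ennreal_mult'' zero_le_power norm_ge_zero
        mult_nonneg_nonneg zero_le_numeral)
  also have "\<dots> = ennreal 8 * ennreal (M4 \<mu>) + ennreal 8 * ennreal (M4 \<nu>)"
    by (subst nn_integral_add, measurable, subst (1 2) nn_integral_cmult, measurable)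
       (simp only: f1 f2)
  also have "\<dots> = ennreal (8 * M4 \<mu> + 8 * M4 \<nu>)"
    using M4_nonneg by (simp only: ennreal_plus ennreal_mult'' mult_nonneg_nonneg zero_le_numeral)
  finally have f: "(\<integral>\<^sup>+p. ennreal (?f p) \<partial>\<pi>) = ennreal (8 * M4 \<mu> + 8 * M4 \<nu>)" .
  have "(\<integral>\<^sup>+z. ennreal (quartic_growth z) \<partial>(\<pi> \<Otimes>\<^sub>M \<pi>)) =
      (\<integral>\<^sup>+p. \<integral>\<^sup>+q. ennreal (quartic_growth (p, q)) \<partial>\<pi> \<partial>\<pi>)"
    by (rule P.nn_integral_fst[symmetric]) measurable
  also have "\<dots> = (\<integral>\<^sup>+p. \<integral>\<^sup>+q. (1 + ennreal (?f p)) + ennreal (?f q) \<partial>\<pi> \<partial>\<pi>)"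
    by (intro nn_integral_cong)
       (simp add: quartic_growth_def add.assoc flip: ennreal_1 ennreal_plus)
  also have "\<dots> = (\<integral>\<^sup>+p. (1 + ennreal (?f p)) + ennreal (8 * M4 \<mu> + 8 * M4 \<nu>) \<partial>\<pi>)"
    by (intro nn_integral_cong, subst nn_integral_add)
       (measurable, simp only: f nn_integral_const P.emeasure_space_1 mult_1_right)
  also have "\<dots> = (1 + ennreal (8 * M4 \<mu> + 8 * M4 \<nu>)) + ennreal (8 * M4 \<mu> + 8 * M4 \<nu>)"
    by (subst nn_integral_add, measurable, subst nn_integral_add, measurable)
       (simp only: f nn_integral_const P.emeasure_space_1 mult_1_right)
  also have "\<dots> = ennreal (1 + 16 * M4 \<mu> + 16 * M4 \<nu>)"
    using M4_nonneg by (simp flip: ennreal_1 ennreal_plus)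
  finally show ?thesis .
qed

lemma gw_cost_le_moments: "gw_cost \<pi> \<le> ereal (1 + 16 * M4 \<mu> + 16 * M4 \<nu>)"
proof -
  have "(\<integral>\<^sup>+z. ennreal (gw_gap z) \<partial>(\<pi> \<Otimes>\<^sub>M \<pi>)) \<le> ennreal (1 + 16 * M4 \<mu> + 16 * M4 \<nu>)"
    unfolding nn_integral_quartic_growth[symmetric]
    by (intro nn_integral_mono ennreal_leI gw_gap_le_growth)
  then have "gw_cost \<pi> \<le> enn2ereal (ennreal (1 + 16 * M4 \<mu> + 16 * M4 \<nu>))"
    unfolding gw_cost_eq by (simp only: less_eq_ennreal.rep_eq)
  moreover have "0 \<le> M4 \<mu>" "0 \<le> M4 \<nu>" by (auto simp: M4_def)
  ultimately show ?thesis by (subst (asm) enn2ereal_ennreal) auto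
qed

text \<open>Moving all points by at most \<open>\<eta>\<close> changes the cost by \<open>O(\<eta>)\<close>. The bound holds in both directions
and is uniform over all couplings of \<open>\<mu>\<close> and \<open>\<nu>\<close>.\<close>
lemma gw_cost_perturb:
  assumes [measurable]: "u \<in> borel_measurable borel" "v \<in> borel_measurable borel"
    and u: "\<And>x. norm (u x - x) \<le> \<eta>" and v: "\<And>y. norm (v y - y) \<le> \<eta>"
    and \<eta>: "\<eta> \<le> D" and D: "1 \<le> D"
  defines "B \<equiv> 3456 * D ^ 3 * \<eta> * (1 + 16 * M4 \<mu> + 16 * M4 \<nu>)"
    and "\<pi>' \<equiv> distr \<pi> (borel \<Otimes>\<^sub>M borel) (map_prod u v)"
  shows "gw_cost \<pi> \<le> gw_cost \<pi>' + ereal B" and "gw_cost \<pi>' \<le> gw_cost \<pi> + ereal B"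
proof -
  let ?T = "map_prod u v" and ?c = "3456 * D ^ 3 * \<eta>"
  have [measurable]: "?T \<in> \<pi> \<rightarrow>\<^sub>M borel \<Otimes>\<^sub>M borel"
    unfolding map_prod_def by measurable
  have [measurable]: "gw_gap \<in> borel_measurable
      ((borel \<Otimes>\<^sub>M borel) \<Otimes>\<^sub>M (borel \<Otimes>\<^sub>M borel) :: (('a \<times> 'b) \<times> 'a \<times> 'b) measure)"
    unfolding gw_gap_def[abs_def] by measurable
  have \<eta>0: "0 \<le> \<eta>" using norm_ge_zero u[of undefined] by (rule order_trans)
  then have c: "0 \<le> ?c" using D by simp
  have B0: "0 \<le> B" using c by (auto simp: B_def M4_def)
  interpret P': prob_space \<pi>' unfolding \<pi>'_def by (rule P.prob_space_distr) measurable
  have "\<pi>' \<Otimes>\<^sub>M \<pi>' = distr (\<pi> \<Otimes>\<^sub>M \<pi>) ((borel \<Otimes>\<^sub>M borel) \<Otimes>\<^sub>M (borel \<Otimes>\<^sub>M borel))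
      (\<lambda>(p, q). (?T p, ?T q))"
    using P'.sigma_finite_measure_axioms unfolding \<pi>'_def
    by (intro pair_measure_distr) measurable
  then have cost': "(\<integral>\<^sup>+z. ennreal (gw_gap z) \<partial>(\<pi>' \<Otimes>\<^sub>M \<pi>')) =
      (\<integral>\<^sup>+z. ennreal (gw_gap (?T (fst z), ?T (snd z))) \<partial>(\<pi> \<Otimes>\<^sub>M \<pi>))"
    by (simp add: nn_integral_distr case_prod_beta')
  have meas: "(\<lambda>z. gw_gap (?T (fst z), ?T (snd z))) \<in> borel_measurable (\<pi> \<Otimes>\<^sub>M \<pi>)"
    by measurable
  have growth: "(\<integral>\<^sup>+z. ennreal (?c * quartic_growth z) \<partial>(\<pi> \<Otimes>\<^sub>M \<pi>)) = ennreal B"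
    using c by (simp only: ennreal_mult' B_def)
      (subst nn_integral_cmult, measurable, simp only: nn_integral_quartic_growth)
  have step: "enn2ereal (\<integral>\<^sup>+z. ennreal (F z) \<partial>(\<pi> \<Otimes>\<^sub>M \<pi>)) \<le>
      enn2ereal (\<integral>\<^sup>+z. ennreal (G z) \<partial>(\<pi> \<Otimes>\<^sub>M \<pi>)) + ereal B"
    if [measurable]: "G \<in> borel_measurable (\<pi> \<Otimes>\<^sub>M \<pi>)" and G0: "\<And>z. 0 \<le> G z"
      and le: "\<And>z. F z \<le> G z + ?c * quartic_growth z" for F G
  proof -
    have "(\<integral>\<^sup>+z. ennreal (F z) \<partial>(\<pi> \<Otimes>\<^sub>M \<pi>)) \<le>
        (\<integral>\<^sup>+z. ennreal (G z) + ennreal (?c * quartic_growth z) \<partial>(\<pi> \<Otimes>\<^sub>M \<pi>))"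
    proof (rule nn_integral_mono)
      fix z
      have "ennreal (F z) \<le> ennreal (G z + ?c * quartic_growth z)"
        by (intro ennreal_leI le)
      also have "\<dots> = ennreal (G z) + ennreal (?c * quartic_growth z)"
        by (intro ennreal_plus G0 mult_nonneg_nonneg[OF c quartic_growth_nonneg])
      finally show "ennreal (F z) \<le> ennreal (G z) + ennreal (?c * quartic_growth z)" .
    qed
    also have "\<dots> = (\<integral>\<^sup>+z. ennreal (G z) \<partial>(\<pi> \<Otimes>\<^sub>M \<pi>)) + ennreal B"
      unfolding growth[symmetric] by (rule nn_integral_add) measurable
    finally show ?thesis
      using B0 by (simp add: less_eq_ennreal.rep_eq plus_ennreal.rep_eq enn2ereal_ennreal)
  qed
  have close: "\<bar>gw_gap (?T (fst z), ?T (snd z)) - gw_gap z\<bar> \<le> ?c * quartic_growth z" for z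
    using u v \<eta> D by (rule gw_gap_perturb)
  show "gw_cost \<pi> \<le> gw_cost \<pi>' + ereal B"
    unfolding gw_cost_eq cost'
    by (rule step[OF meas gw_gap_nonneg]) (use close in \<open>simp add: abs_le_iff algebra_simps\<close>)
  show "gw_cost \<pi>' \<le> gw_cost \<pi> + ereal B"
    unfolding gw_cost_eq cost'
    by (rule step[OF borel_measurable_gw_gap gw_gap_nonneg])
       (use close in \<open>simp add: abs_le_iff algebra_simps\<close>)
qed

end

section \<open>The entropy of a cubic grid\<close>

text \<open>The index of the cube of side \<open>\<epsilon>\<close> that contains \<open>x\<close>. Its integer coordinates are encoded as
natural numbers, so that the total mass of the weight below is a power of a series over \<open>\<nat>\<close>.\<close>
definition grid_index :: "real \<Rightarrow> real ^ 'd \<Rightarrow> 'd \<Rightarrow> nat" where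
  "grid_index \<epsilon> x = (\<lambda>k. int_encode \<lfloor>x $ k / \<epsilon>\<rfloor>)"

text \<open>The corner of the cube with index \<open>b\<close> at which all coordinates are minimal.\<close>
definition grid_point :: "real \<Rightarrow> ('d \<Rightarrow> nat) \<Rightarrow> real ^ 'd" where
  "grid_point \<epsilon> b = (\<chi> k. \<epsilon> * real_of_int (int_decode (b k)))"

text \<open>A summable weight on the cubes of the grid, which does not depend on the side. Its polynomial decay
makes \<open>- ln (grid_weight b)\<close> grow only logarithmically in \<open>b\<close>.\<close>
definition grid_weight :: "('d::finite \<Rightarrow> nat) \<Rightarrow> real" where
  "grid_weight b = (\<Prod>k\<in>UNIV. 1 / (1 + real (b k))\<^sup>2)"

lemma measurable_grid_index [measurable]:
  "grid_index \<epsilon> \<in> (borel :: (real ^ 'd) measure) \<rightarrow>\<^sub>M count_space UNIV"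
proof -
  have "Measurable.pred borel (\<lambda>x :: real ^ 'd. \<forall>k. int_encode \<lfloor>x $ k / \<epsilon>\<rfloor> = a k)" for a
    by measurable
  then show ?thesis
    by (auto simp: measurable_count_space_eq_countable grid_index_def fun_eq_iff vimage_def
        pred_def)
qed

lemma norm_grid_point_diff_le:
  fixes x :: "real ^ 'd"
  assumes "0 < \<epsilon>"
  shows "norm (grid_point \<epsilon> (grid_index \<epsilon> x) - x) \<le> real CARD('d) * \<epsilon>"
proof -
  have "norm (grid_point \<epsilon> (grid_index \<epsilon> x) - x) \<le>
      (\<Sum>k\<in>UNIV. \<bar>(grid_point \<epsilon> (grid_index \<epsilon> x) - x) $ k\<bar>)"
    by (rule norm_le_l1_cart)
  also have "\<dots> \<le> (\<Sum>k\<in>(UNIV :: 'd set). \<epsilon>)"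
  proof (rule sum_mono)
    fix k
    define m where "m = real_of_int \<lfloor>x $ k / \<epsilon>\<rfloor>"
    have "m \<le> x $ k / \<epsilon>" "x $ k / \<epsilon> \<le> m + 1"
      unfolding m_def by linarith+
    then have "\<epsilon> * m \<le> x $ k" "x $ k \<le> \<epsilon> * m + \<epsilon>"
      using assms by (simp_all add: field_simps)
    then show "\<bar>(grid_point \<epsilon> (grid_index \<epsilon> x) - x) $ k\<bar> \<le> \<epsilon>"
      by (simp add: grid_point_def grid_index_def abs_le_iff m_def)
  qed
  also have "\<dots> = real CARD('d) * \<epsilon>" by simp
  finally show ?thesis .
qed

lemma grid_weight_pos: "0 < grid_weight b"
  unfolding grid_weight_def by (intro prod_pos) (simp add: add_pos_nonneg)

lemma summable_inverse_squares: "summable (\<lambda>n. 1 / (1 + real n)\<^sup>2)"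
proof -
  have "summable (\<lambda>n. 1 / real (Suc n) ^ 2)"
    using inverse_power_summable[of 2, where 'a = real]
    by (subst summable_Suc_iff) (simp add: inverse_eq_divide)
  then show ?thesis by simp
qed

lemma nn_integral_grid_weight:
  "(\<integral>\<^sup>+b. ennreal (grid_weight (b :: 'd::finite \<Rightarrow> nat)) \<partial>count_space UNIV) =
    ennreal ((\<Sum>n. 1 / (1 + real n)\<^sup>2) ^ CARD('d))"
proof -
  interpret product_sigma_finite "\<lambda>_ :: 'd. count_space (UNIV :: nat set)"
    by (simp add: product_sigma_finite_def sigma_finite_measure_count_space)
  have "count_space (UNIV :: ('d \<Rightarrow> nat) set) = Pi\<^sub>M UNIV (\<lambda>_. count_space UNIV)"
    using count_space_PiM_finite[of "UNIV :: 'd set" "\<lambda>_. UNIV :: nat set"] by simp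
  then have "(\<integral>\<^sup>+b. ennreal (grid_weight (b :: 'd \<Rightarrow> nat)) \<partial>count_space UNIV) =
      (\<integral>\<^sup>+b. (\<Prod>k\<in>UNIV. ennreal (1 / (1 + real (b k))\<^sup>2)) \<partial>Pi\<^sub>M UNIV (\<lambda>_::'d. count_space UNIV))"
    by (simp add: grid_weight_def prod_ennreal)
  also have "\<dots> = (\<Prod>k\<in>(UNIV :: 'd set). \<integral>\<^sup>+n. ennreal (1 / (1 + real n)\<^sup>2) \<partial>count_space UNIV)"
    by (rule product_nn_integral_prod) simp_all
  also have "(\<integral>\<^sup>+n. ennreal (1 / (1 + real n)\<^sup>2) \<partial>count_space UNIV) =
      ennreal (\<Sum>n. 1 / (1 + real n)\<^sup>2)"
    by (simp add: nn_integral_count_space_nat suminf_ennreal2 summable_inverse_squares)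
  finally show ?thesis
    by (simp add: ennreal_power suminf_nonneg summable_inverse_squares)
qed

lemma minus_ln_grid_weight_le:
  fixes x :: "real ^ 'd"
  assumes \<epsilon>: "0 < \<epsilon>" "\<epsilon> \<le> 1"
  shows "- ln (grid_weight (grid_index \<epsilon> x)) \<le>
    2 * real CARD('d) * (ln (1 / \<epsilon>) + 4 + 2 * norm x ^ 4)"
proof -
  have enc: "real (int_encode m) \<le> 2 * \<bar>real_of_int m\<bar>" for m
    by (auto simp: int_encode_def sum_encode_def)
  have coord: "ln (1 + real (grid_index \<epsilon> x k)) \<le> ln (1 / \<epsilon>) + 4 + 2 * norm x ^ 4" for k
  proof -
    have "\<bar>x $ k / \<epsilon>\<bar> \<le> norm x / \<epsilon>"
      using component_le_norm_cart[of x k] \<epsilon> by (simp add: abs_div divide_right_mono)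
    moreover have "\<bar>real_of_int \<lfloor>x $ k / \<epsilon>\<rfloor>\<bar> \<le> \<bar>x $ k / \<epsilon>\<bar> + 1" by linarith
    ultimately have "1 + real (grid_index \<epsilon> x k) \<le> 3 + 2 * (norm x / \<epsilon>)"
      using enc[of "\<lfloor>x $ k / \<epsilon>\<rfloor>"] unfolding grid_index_def by linarith
    also have "\<dots> \<le> (3 + 2 * norm x) * (1 / \<epsilon>)"
      using \<epsilon> by (simp add: field_simps)
    finally have "ln (1 + real (grid_index \<epsilon> x k)) \<le> ln ((3 + 2 * norm x) * (1 / \<epsilon>))"
      by (intro ln_mono) auto
    also have "\<dots> = ln (3 + 2 * norm x) + ln (1 / \<epsilon>)"
      using \<epsilon> by (intro ln_mult_pos) (auto intro: add_pos_nonneg)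
    also have "ln (3 + 2 * norm x) \<le> 2 + 2 * norm x"
      using ln_le_minus_one[of "3 + 2 * norm x"] by (simp add: add_pos_nonneg)
    also have "norm x \<le> 1 + norm x ^ 4"
    proof (cases "norm x \<le> 1")
      case False
      then show ?thesis using power_increasing[of 1 4 "norm x"] by simp
    qed (simp add: add_increasing2)
    finally show ?thesis by simp
  qed
  have "- ln (grid_weight (grid_index \<epsilon> x)) =
      (\<Sum>k\<in>UNIV. 2 * ln (1 + real (grid_index \<epsilon> x k)))"
    unfolding grid_weight_def
    by (subst ln_prod) (auto simp: add_pos_nonneg ln_div ln_realpow sum_negf)
  also have "\<dots> \<le> (\<Sum>k\<in>(UNIV :: 'd set). 2 * (ln (1 / \<epsilon>) + 4 + 2 * norm x ^ 4))"
    by (intro sum_mono mult_left_mono coord) simp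
  finally show ?thesis by (simp add: algebra_simps)
qed

lemma grid_entropy_le:
  fixes \<nu> :: "(real ^ 'd) measure"
  assumes \<nu>: "\<nu> \<in> P4" and \<epsilon>: "0 < \<epsilon>" "\<epsilon> \<le> 1"
  defines "n \<equiv> \<lambda>b. measure \<nu> (grid_index \<epsilon> -` {b} \<inter> space \<nu>)"
  shows "integrable \<nu> (\<lambda>y. - ln (n (grid_index \<epsilon> y)))" (is ?int)
    and "(\<integral>y. - ln (n (grid_index \<epsilon> y)) \<partial>\<nu>) \<le>
      2 * real CARD('d) * (ln (1 / \<epsilon>) + 4 + 2 * M4 \<nu>) + (\<Sum>n. 1 / (1 + real n)\<^sup>2) ^ CARD('d)"
      (is ?le)
proof -
  interpret prob_space \<nu> using \<nu> by (simp add: P4_def)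
  have sets [measurable_cong]: "sets \<nu> = sets borel" using \<nu> by (simp add: P4_def)
  have index: "grid_index \<epsilon> \<in> \<nu> \<rightarrow>\<^sub>M count_space UNIV" by measurable
  define w :: "real ^ 'd \<Rightarrow> real" where "w y = - ln (grid_weight (grid_index \<epsilon> y))" for y
  define g :: "real ^ 'd \<Rightarrow> real"
    where "g y = 2 * real CARD('d) * (ln (1 / \<epsilon>) + 4 + 2 * norm y ^ 4)" for y
  have g_int: "integrable \<nu> g"
    using \<nu> unfolding g_def P4_def by auto
  have w_meas: "w \<in> borel_measurable \<nu>"
    unfolding w_def by (rule measurable_compose[OF index]) simp
  have "grid_weight b \<le> 1" for b :: "'d \<Rightarrow> nat"
    unfolding grid_weight_def by (intro prod_le_1) (auto simp: divide_le_eq_1 add_pos_nonneg one_le_power)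
  then have w_nonneg: "0 \<le> w y" for y
    by (simp add: w_def ln_le_zero_iff[OF grid_weight_pos])
  have w_le: "w y \<le> g y" for y
    unfolding w_def g_def using \<epsilon> by (rule minus_ln_grid_weight_le)
  have w_int: "integrable \<nu> w"
    by (rule Bochner_Integration.integrable_bound[OF g_int w_meas])
       (use w_nonneg w_le in \<open>auto intro: order_trans[OF _ abs_ge_self]\<close>)
  have S: "0 \<le> (\<Sum>n. 1 / (1 + real n)\<^sup>2) ^ CARD('d)"
    by (simp add: suminf_nonneg summable_inverse_squares)
  note gibbs = cell_entropy_le[where w = grid_weight, OF prob_space_axioms index grid_weight_pos
      order_eq_refl[OF nn_integral_grid_weight[where 'd = 'd]] S w_int[unfolded w_def]]
  show ?int unfolding n_def by (rule gibbs(1))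
  have "(\<integral>y. - ln (n (grid_index \<epsilon> y)) \<partial>\<nu>) \<le> (\<integral>y. w y \<partial>\<nu>) +
      (\<Sum>n. 1 / (1 + real n)\<^sup>2) ^ CARD('d)"
    unfolding n_def w_def by (rule gibbs(2))
  also have "(\<integral>y. w y \<partial>\<nu>) \<le> (\<integral>y. g y \<partial>\<nu>)"
    by (intro integral_mono w_int g_int w_le)
  also have "\<dots> = 2 * real CARD('d) * (ln (1 / \<epsilon>) + 4 + 2 * M4 \<nu>)"
    using \<nu> unfolding g_def by (simp add: P4_def M4_def prob_space)
  finally show ?le by simp
qed

section \<open>The comparison of the two functionals\<close>

lemma block_approximation:
  fixes \<mu> :: "(real ^ 'dx) measure" and \<nu> :: "(real ^ 'dy) measure"
  assumes \<mu>: "\<mu> \<in> P4" and \<nu>: "\<nu> \<in> P4" and \<pi>: "\<pi> \<in> couplings \<mu> \<nu>"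
    and \<epsilon>: "0 < \<epsilon>" "\<epsilon> \<le> 1"
  defines "D \<equiv> real CARD('dx) + real CARD('dy)"
  obtains \<pi>' where "\<pi>' \<in> couplings \<mu> \<nu>"
    and "gw_cost \<pi>' \<le> gw_cost \<pi> + ereal (6912 * D ^ 4 * \<epsilon> * (1 + 16 * M4 \<mu> + 16 * M4 \<nu>))"
    and "D_KL \<pi>' (\<mu> \<Otimes>\<^sub>M \<nu>) \<le> ereal (2 * real CARD('dy) * (ln (1 / \<epsilon>) + 4 + 2 * M4 \<nu>) +
      (\<Sum>n. 1 / (1 + real n)\<^sup>2) ^ CARD('dy))"
proof -
  have [measurable_cong]: "sets \<mu> = sets borel" "sets \<nu> = sets borel"
    using \<mu> \<nu> by (auto simp: P4_def)
  interpret cell_coupling \<mu> \<nu> \<pi> "grid_index \<epsilon>" "grid_index \<epsilon>"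
  proof (intro cell_coupling.intro cell_coupling_axioms.intro \<pi>)
    show "prob_space \<mu>" "prob_space \<nu>" using \<mu> \<nu> by (auto simp: P4_def)
  qed measurable
  let ?q = "\<lambda>x :: real ^ 'dx. grid_point \<epsilon> (grid_index \<epsilon> x)"
  let ?r = "\<lambda>y :: real ^ 'dy. grid_point \<epsilon> (grid_index \<epsilon> y)"
  let ?\<pi>' = block_coupling
  have meas: "?q \<in> borel_measurable borel" "?r \<in> borel_measurable borel"
    by (rule measurable_compose[OF measurable_grid_index], simp)+
  have D: "1 \<le> D"
    by (simp add: D_def Suc_le_eq add_increasing2)
  then have \<eta>: "D * \<epsilon> \<le> D"
    using \<epsilon> mult_left_mono[of \<epsilon> 1 D] by simp
  have q: "norm (?q x - x) \<le> D * \<epsilon>" for x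
    using norm_grid_point_diff_le[OF \<epsilon>(1), of x] \<epsilon> by (simp add: D_def algebra_simps add_increasing2)
  have r: "norm (?r y - y) \<le> D * \<epsilon>" for y
    using norm_grid_point_diff_le[OF \<epsilon>(1), of y] \<epsilon> by (simp add: D_def algebra_simps add_increasing)
  have quant: "distr Q (borel \<Otimes>\<^sub>M borel) (map_prod ?q ?r) =
      distr (distr Q (count_space UNIV) (\<lambda>z. (grid_index \<epsilon> (fst z), grid_index \<epsilon> (snd z))))
        (borel \<Otimes>\<^sub>M borel) (map_prod (grid_point \<epsilon>) (grid_point \<epsilon>))"
    if [measurable_cong]: "sets Q = sets (\<mu> \<Otimes>\<^sub>M \<nu>)" for Q
  proof -
    have "(\<lambda>z. (grid_index \<epsilon> (fst z), grid_index \<epsilon> (snd z))) \<in> Q \<rightarrow>\<^sub>M count_space UNIV"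
      using measurable_index by (simp add: measurable_cong_sets[OF that refl])
    then show ?thesis
      by (subst distr_distr) (auto simp: comp_def map_prod_def case_prod_beta' space_pair_measure)
  qed
  have same: "distr ?\<pi>' (borel \<Otimes>\<^sub>M borel) (map_prod ?q ?r) =
      distr \<pi> (borel \<Otimes>\<^sub>M borel) (map_prod ?q ?r)"
    by (simp add: quant sets_coupling sets_block_coupling distr_block_coupling_index)
  let ?B = "3456 * D ^ 3 * (D * \<epsilon>) * (1 + 16 * M4 \<mu> + 16 * M4 \<nu>)"
  \<comment> \<open>Rounding factors through the cell indices, so \<open>\<pi>\<close> and its block approximation have the same
    rounded image, and the cost changes by at most \<open>?B\<close> on either side.\<close>
  have "gw_cost ?\<pi>' \<le> gw_cost (distr \<pi> (borel \<Otimes>\<^sub>M borel) (map_prod ?q ?r)) + ereal ?B"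
    using gw_cost_perturb(1)[OF \<mu> \<nu> block_coupling_in_couplings meas q r \<eta> D] by (simp only: same)
  also have "\<dots> \<le> (gw_cost \<pi> + ereal ?B) + ereal ?B"
    by (intro add_right_mono gw_cost_perturb(2)[OF \<mu> \<nu> \<pi> meas q r \<eta> D])
  also have "\<dots> = gw_cost \<pi> + ereal (6912 * D ^ 4 * \<epsilon> * (1 + 16 * M4 \<mu> + 16 * M4 \<nu>))"
    by (simp add: add.assoc power4_eq_xxxx power3_eq_cube mult.assoc)
  finally have cost: "gw_cost ?\<pi>' \<le> \<dots>" .
  have "D_KL ?\<pi>' (\<mu> \<Otimes>\<^sub>M \<nu>) \<le> ereal (\<integral>y. - ln (snd_mass (grid_index \<epsilon> y)) \<partial>\<nu>)"
    by (rule D_KL_block_coupling_le)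
       (unfold snd_mass_def, rule grid_entropy_le(1)[OF \<nu> \<epsilon>])
  also have "\<dots> \<le> ereal (2 * real CARD('dy) * (ln (1 / \<epsilon>) + 4 + 2 * M4 \<nu>) +
      (\<Sum>n. 1 / (1 + real n)\<^sup>2) ^ CARD('dy))"
    unfolding snd_mass_def ereal_less_eq by (rule grid_entropy_le(2)[OF \<nu> \<epsilon>])
  finally show ?thesis using that block_coupling_in_couplings cost by blast
qed

lemma product_in_couplings:
  assumes "prob_space \<mu>" "prob_space \<nu>"
  shows "\<mu> \<Otimes>\<^sub>M \<nu> \<in> couplings \<mu> \<nu>"
proof -
  interpret pair_prob_space \<mu> \<nu> using assms by (simp add: pair_prob_space_def pair_sigma_finite_def
    prob_space_imp_sigma_finite)
  have "distr (density (\<mu> \<Otimes>\<^sub>M \<nu>) (\<lambda>_. 1)) \<mu> fst = \<mu>"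
    by (rule density_fst_marginal) (auto intro: M2.sigma_finite_measure_axioms simp: M2.emeasure_space_1)
  moreover have "distr (density (\<mu> \<Otimes>\<^sub>M \<nu>) (\<lambda>_. 1)) \<nu> snd = \<nu>"
    by (rule density_snd_marginal)
       (auto intro: M1.sigma_finite_measure_axioms M2.sigma_finite_measure_axioms
         simp: M1.emeasure_space_1)
  ultimately show ?thesis
    by (simp add: couplings_def density_1 P.prob_space_axioms)
qed

lemma GW_sq_le_EGW:
  assumes "prob_space \<mu>" "prob_space \<nu>" "0 \<le> \<epsilon>"
  shows "GW_sq \<mu> \<nu> \<le> EGW \<epsilon> \<mu> \<nu>"
  unfolding GW_sq_def EGW_def
proof (rule INF_mono)
  fix \<pi> assume \<pi>: "\<pi> \<in> couplings \<mu> \<nu>"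
  have "prob_space (\<mu> \<Otimes>\<^sub>M \<nu>)"
    using product_in_couplings[OF assms(1,2)] by (simp add: couplings_def)
  then have "0 \<le> D_KL \<pi> (\<mu> \<Otimes>\<^sub>M \<nu>)"
    using \<pi> by (intro D_KL_nonneg) (auto simp: couplings_def)
  then have "gw_cost \<pi> + 0 \<le> gw_cost \<pi> + ereal \<epsilon> * D_KL \<pi> (\<mu> \<Otimes>\<^sub>M \<nu>)"
    using assms(3) by (intro add_left_mono) auto
  then show "\<exists>\<pi>'\<in>couplings \<mu> \<nu>. gw_cost \<pi>' \<le> gw_cost \<pi> + ereal \<epsilon> * D_KL \<pi> (\<mu> \<Otimes>\<^sub>M \<nu>)"
    using \<pi> by auto
qed

lemma abs_GW_sq_finite:
  assumes \<mu>: "\<mu> \<in> P4" and \<nu>: "\<nu> \<in> P4"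
  shows "\<bar>GW_sq \<mu> \<nu>\<bar> \<noteq> \<infinity>"
proof -
  have prod: "\<mu> \<Otimes>\<^sub>M \<nu> \<in> couplings \<mu> \<nu>"
    using \<mu> \<nu> by (intro product_in_couplings) (auto simp: P4_def)
  then have "GW_sq \<mu> \<nu> \<le> gw_cost (\<mu> \<Otimes>\<^sub>M \<nu>)"
    unfolding GW_sq_def by (rule INF_lower)
  also have "\<dots> \<le> ereal (1 + 16 * M4 \<mu> + 16 * M4 \<nu>)"
    by (rule gw_cost_le_moments[OF \<mu> \<nu> prod])
  finally have "GW_sq \<mu> \<nu> \<noteq> \<infinity>" by auto
  moreover have "0 \<le> GW_sq \<mu> \<nu>"
    unfolding GW_sq_def by (rule INF_greatest) (simp add: gw_cost_def)
  ultimately show ?thesis by auto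
qed

theorem proposition1:
  shows "\<exists>C :: real \<Rightarrow> real \<Rightarrow> real.
    \<forall>\<epsilon> :: real. 0 < \<epsilon> \<and> \<epsilon> \<le> 1 \<longrightarrow>
      (\<forall>\<mu> \<in> (P4 :: (real ^ 'dx) measure set). \<forall>\<nu> \<in> (P4 :: (real ^ 'dy) measure set).
        \<bar>EGW \<epsilon> \<mu> \<nu> - GW_sq \<mu> \<nu>\<bar> \<le> ereal (C (M4 \<mu>) (M4 \<nu>) * eps_log_rate \<epsilon>))"
proof -
  define D where "D = real CARD('dx) + real CARD('dy)"
  define S where "S = (\<Sum>n. 1 / (1 + real n)\<^sup>2) ^ CARD('dy)"
  define a where "a m n = 6912 * D ^ 4 * (1 + 16 * m + 16 * n)" for m n :: real
  define C where "C m n = a m n + (2 * real CARD('dy) * (5 + 2 * n) + S)" for m n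
  have S: "0 \<le> S"
    by (simp add: S_def suminf_nonneg summable_inverse_squares)
  have "\<bar>EGW \<epsilon> \<mu> \<nu> - GW_sq \<mu> \<nu>\<bar> \<le> ereal (C (M4 \<mu>) (M4 \<nu>) * eps_log_rate \<epsilon>)"
    if \<epsilon>: "0 < \<epsilon>" "\<epsilon> \<le> 1" and \<mu>: "\<mu> \<in> P4" and \<nu>: "\<nu> \<in> P4"
    for \<epsilon> and \<mu> :: "(real ^ 'dx) measure" and \<nu> :: "(real ^ 'dy) measure"
  proof -
    define L where "L = max 1 (ln (1 / \<epsilon>))"
    have L: "1 \<le> L" "ln (1 / \<epsilon>) \<le> L" by (auto simp: L_def)
    let ?b = "2 * real CARD('dy) * (ln (1 / \<epsilon>) + 4 + 2 * M4 \<nu>) + S"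
    have M4: "0 \<le> M4 \<mu>" "0 \<le> M4 \<nu>" by (auto simp: M4_def)
    \<comment> \<open>\<open>1 \<le> L\<close> absorbs the terms that are constant in \<open>\<epsilon>\<close>: this uses the cut-off in the rate.\<close>
    have rate: "\<epsilon> * a (M4 \<mu>) (M4 \<nu>) + \<epsilon> * ?b \<le> C (M4 \<mu>) (M4 \<nu>) * eps_log_rate \<epsilon>"
    proof -
      have "1 * (4 + 2 * M4 \<nu>) \<le> L * (4 + 2 * M4 \<nu>)"
        using L M4 by (intro mult_right_mono) auto
      then have "2 * real CARD('dy) * (ln (1 / \<epsilon>) + 4 + 2 * M4 \<nu>) \<le>
          2 * real CARD('dy) * (L * (5 + 2 * M4 \<nu>))"
        using L by (intro mult_left_mono) (auto simp: algebra_simps)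
      moreover have "1 * S \<le> L * S" using L S by (intro mult_right_mono) auto
      moreover have "1 * a (M4 \<mu>) (M4 \<nu>) \<le> L * a (M4 \<mu>) (M4 \<nu>)"
        using L M4 by (intro mult_right_mono) (auto simp: a_def)
      ultimately have "a (M4 \<mu>) (M4 \<nu>) + ?b \<le> C (M4 \<mu>) (M4 \<nu>) * L"
        by (simp add: C_def algebra_simps)
      then have "\<epsilon> * (a (M4 \<mu>) (M4 \<nu>) + ?b) \<le> \<epsilon> * (C (M4 \<mu>) (M4 \<nu>) * L)"
        using \<epsilon> by (intro mult_left_mono) auto
      then show ?thesis by (simp add: eps_log_rate_def L_def algebra_simps)
    qed
    have upper: "EGW \<epsilon> \<mu> \<nu> \<le> gw_cost \<pi> + ereal (C (M4 \<mu>) (M4 \<nu>) * eps_log_rate \<epsilon>)"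
      if \<pi>: "\<pi> \<in> couplings \<mu> \<nu>" for \<pi>
    proof -
      have a_eq: "6912 * D ^ 4 * \<epsilon> * (1 + 16 * M4 \<mu> + 16 * M4 \<nu>) = \<epsilon> * a (M4 \<mu>) (M4 \<nu>)"
        by (simp add: a_def)
      obtain \<pi>' where \<pi>': "\<pi>' \<in> couplings \<mu> \<nu>"
        and cost: "gw_cost \<pi>' \<le> gw_cost \<pi> + ereal (\<epsilon> * a (M4 \<mu>) (M4 \<nu>))"
        and KL: "D_KL \<pi>' (\<mu> \<Otimes>\<^sub>M \<nu>) \<le> ereal ?b"
        using block_approximation[OF \<mu> \<nu> \<pi> \<epsilon>, folded D_def S_def, unfolded a_eq] by blast
      have "EGW \<epsilon> \<mu> \<nu> \<le> gw_cost \<pi>' + ereal \<epsilon> * D_KL \<pi>' (\<mu> \<Otimes>\<^sub>M \<nu>)"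
        unfolding EGW_def using \<pi>' by (rule INF_lower)
      also have "\<dots> \<le> (gw_cost \<pi> + ereal (\<epsilon> * a (M4 \<mu>) (M4 \<nu>))) + ereal \<epsilon> * ereal ?b"
        using \<epsilon> by (intro add_mono cost ereal_mult_left_mono KL) auto
      also have "\<dots> = gw_cost \<pi> + ereal (\<epsilon> * a (M4 \<mu>) (M4 \<nu>) + \<epsilon> * ?b)"
        by (simp add: add.assoc)
      also have "\<dots> \<le> gw_cost \<pi> + ereal (C (M4 \<mu>) (M4 \<nu>) * eps_log_rate \<epsilon>)"
        using rate by (intro add_left_mono) simp
      finally show ?thesis .
    qed
    let ?R = "C (M4 \<mu>) (M4 \<nu>) * eps_log_rate \<epsilon>"
    have "EGW \<epsilon> \<mu> \<nu> - ereal ?R \<le> GW_sq \<mu> \<nu>"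
      unfolding GW_sq_def using upper by (intro INF_greatest) (simp add: ereal_minus_le)
    then have "EGW \<epsilon> \<mu> \<nu> \<le> GW_sq \<mu> \<nu> + ereal ?R"
      by (simp add: ereal_minus_le)
    moreover have "GW_sq \<mu> \<nu> \<le> EGW \<epsilon> \<mu> \<nu>"
      using \<mu> \<nu> \<epsilon> by (intro GW_sq_le_EGW) (auto simp: P4_def)
    ultimately show ?thesis
      using abs_GW_sq_finite[OF \<mu> \<nu>]
      by (cases "GW_sq \<mu> \<nu>"; cases "EGW \<epsilon> \<mu> \<nu>") auto
  qed
  then show ?thesis by blast
qed

end
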